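(* Let $X$ be a set and let $\mathscr{A}$ and $\mathscr{B}$ be collections of families of subsets of $X$. If $X$ satisfies the principle $\mathbf{S}_1^*(\mathscr{A},\mathscr{B})$, then $X$ satisfies the principle $\mathbf{CS}_1(\mathscr{A},\mathscr{R}_{\mathscr{B}}^-)$.
   Context: For a set $Y$, $[Y]^{<\omega}$ is the collection of all finite subsets of $Y$ (including $\emptyset$; $\bigcup\emptyset=\emptyset$). For $A\subseteq X$ and a family $\mathcal{U}$ of subsets of $X$, $St(A,\mathcal{U})=\bigcup\{U\in\mathcal{U}:U\cap A\neq\emptyset\}$. For families $\mathcal{A},\mathcal{B}$ of sets, $\mathcal{A}$ refines $\mathcal{B}$, written $\mathcal{A}\prec\mathcal{B}$, if for every $A\in\mathcal{A}$ there is $B\in\mathcal{B}$ with $A\subseteq B$. For a collection $\mathscr{B}$ of families of subsets of $X$, $\mathscr{R}_{\mathscr{B}}^-=\{\mathcal{R}:\text{there exists }\mathcal{B}\in\mathscr{B}\text{ such that }\mathcal{R}\prec\mathcal{B}\}$, where $\mathcal{R}$ ranges over families of subsets of $X$. For collections $\mathscr{A},\mathscr{B}$ of families of subsets of $X$: $\mathbf{S}^*_1(\mathscr{A},\mathscr{B})$: for any sequence $\{\mathcal{A}_n:n\in\omega\}$ of elements of $\mathscr{A}$ there is a sequence $\{B_n:n\in\omega\}$ such that $B_n\in\mathcal{A}_n$ for each $n\in\omega$, and $\{St(B_n,\mathcal{A}_n):n\in\omega\}\in\mathscr{B}$. $\mathbf{CS}_1(\mathscr{A},\mathscr{B})$: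 for any sequence $\{\mathcal{U}_n:n\in\omega\}$ of elements of $\mathscr{A}$ there is a sequence $\{U_n:n\in\omega\}$ such that $U_n\in\mathcal{U}_n$ for each $n\in\omega$, and $\bigcup\{\mathcal{V}_n:n\in\omega\}\in\mathscr{B}$, where $\mathcal{V}_n=\{\bigcup\mathcal{V}:\mathcal{V}\in[\mathcal{U}_n]^{<\omega}\text{ and }U_n\cap V\neq\emptyset\text{ for each }V\in\mathcal{V}\}$. *)

theory Defs
  imports Main
begin

definition star :: "'a set \<Rightarrow> 'a set set \<Rightarrow> 'a set" where
  "star A \<U> = \<Union>{U \<in> \<U>. U \<inter> A \<noteq> {}}"

definition refines :: "'a set set \<Rightarrow> 'a set set \<Rightarrow> bool" where
  "refines \<A> \<B> \<longleftrightarrow> (\<forall>A\<in>\<A>. \<exists>B\<in>\<B>. A \<subseteq> B)"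

definition lower_refinements :: "'a set \<Rightarrow> 'a set set set \<Rightarrow> 'a set set set" where
  "lower_refinements X BB = {\<R>. \<R> \<subseteq> Pow X \<and> (\<exists>\<B>\<in>BB. refines \<R> \<B>)}"

text \<open>The ground set does not occur in the two selection principles: it only enters through the
  collections \<open>AA\<close> and \<open>BB\<close> of families of its subsets.\<close>

definition S1_star :: "'a set set set \<Rightarrow> 'a set set set \<Rightarrow> bool" where
  "S1_star AA BB \<longleftrightarrow>
     (\<forall>\<A> :: nat \<Rightarrow> 'a set set. (\<forall>n. \<A> n \<in> AA) \<longrightarrow>
       (\<exists>B :: nat \<Rightarrow> 'a set. (\<forall>n. B n \<in> \<A> n) \<and> {star (B n) (\<A> n) | n. True} \<in> BB))"

definition finite_unions_meeting :: "'a set \<Rightarrow> 'a set set \<Rightarrow> 'a set set" where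
  "finite_unions_meeting U \<U> =
     {\<Union>\<V> | \<V>. \<V> \<subseteq> \<U> \<and> finite \<V> \<and> (\<forall>V\<in>\<V>. U \<inter> V \<noteq> {})}"

definition CS1 :: "'a set set set \<Rightarrow> 'a set set set \<Rightarrow> bool" where
  "CS1 AA BB \<longleftrightarrow>
     (\<forall>\<U> :: nat \<Rightarrow> 'a set set. (\<forall>n. \<U> n \<in> AA) \<longrightarrow>
       (\<exists>U :: nat \<Rightarrow> 'a set. (\<forall>n. U n \<in> \<U> n) \<and>
          (\<Union>n. finite_unions_meeting (U n) (\<U> n)) \<in> BB))"

end

theory Submission
  imports Defs
begin

text \<open>For a sequence of families \<open>\<U> n\<close> in \<open>AA\<close>, the sets \<open>B n\<close> selected by the star principle
  also serve as the selection required by the other principle: a union of members of \<open>\<U> n\<close>,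
  each of which meets \<open>B n\<close>, is contained in \<open>star (B n) (\<U> n)\<close>. So all these unions together
  form a family of subsets of \<open>X\<close> that refines the family of the stars, which belongs to \<open>BB\<close>.\<close>

lemma finite_unions_meeting_subset_star:
  assumes "W \<in> finite_unions_meeting U \<U>"
  shows "W \<subseteq> star U \<U>"
  using assms unfolding finite_unions_meeting_def star_def by blast

lemma finite_unions_meeting_subset_Pow:
  assumes "\<U> \<subseteq> Pow X"
  shows "finite_unions_meeting U \<U> \<subseteq> Pow X"
  using assms unfolding finite_unions_meeting_def by blast

theorem theorem3p2:
  fixes X :: "'a set" and AA BB :: "'a set set set"
  assumes "AA \<subseteq> Pow (Pow X)" and "BB \<subseteq> Pow (Pow X)"
    and "S1_star AA BB"
  shows "CS1 AA (lower_refinements X BB)"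
  unfolding CS1_def
proof (intro allI impI)
  fix \<U> :: "nat \<Rightarrow> 'a set set"
  assume \<U>: "\<forall>n. \<U> n \<in> AA"
  have "\<exists>B. (\<forall>n. B n \<in> \<U> n) \<and> {star (B n) (\<U> n) | n. True} \<in> BB"
    using assms(3)[unfolded S1_star_def, rule_format, of \<U>] \<U> by simp
  then obtain B where B: "\<forall>n. B n \<in> \<U> n" and stars: "{star (B n) (\<U> n) | n. True} \<in> BB"
    by (elim exE conjE)
  let ?R = "\<Union>n. finite_unions_meeting (B n) (\<U> n)"
  have "\<U> n \<subseteq> Pow X" for n
    using \<U> assms(1) by blast
  then have "?R \<subseteq> Pow X"
    by (intro UN_least finite_unions_meeting_subset_Pow)
  moreover have "refines ?R {star (B n) (\<U> n) | n. True}"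
    unfolding refines_def
  proof
    fix W
    assume "W \<in> ?R"
    then obtain n where "W \<in> finite_unions_meeting (B n) (\<U> n)"
      by (rule UN_E)
    then have "W \<subseteq> star (B n) (\<U> n)"
      by (rule finite_unions_meeting_subset_star)
    then show "\<exists>S\<in>{star (B n) (\<U> n) | n. True}. W \<subseteq> S"
      by auto
  qed
  ultimately have "?R \<in> lower_refinements X BB"
    unfolding lower_refinements_def using stars by auto
  with B show "\<exists>U. (\<forall>n. U n \<in> \<U> n) \<and>
      (\<Union>n. finite_unions_meeting (U n) (\<U> n)) \<in> lower_refinements X BB"
    by (intro exI conjI)
qed

end
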